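(* For every integer $n>4$, there are exactly $4n$ modular consecutive Latin squares of order $n$.
   Context: A Latin square of order $n$ is an $n\times n$ table filled with the integers $1,\dots,n$ so that each integer appears exactly once in each row and in each column. A modular consecutive Latin square of order $n>2$ is a Latin square in which any two orthogonally adjacent cells (horizontal or vertical neighbors, no wrap-around) contain numbers that are consecutive modulo $n$, i.e. they differ by exactly $1$ or they are $1$ and $n$. *)

theory Defs
  imports Main "HOL-Library.FuncSet"
begin

(* A table is a function on pairs (row, column), both counted from 1. Using the extensional
   function space makes equality of squares agree with equality of tables, so that squares
   can be counted. *)
definition latin_square :: "nat \<Rightarrow> (nat \<times> nat \<Rightarrow> nat) \<Rightarrow> bool" where
  "latin_square n L \<longleftrightarrow>
     L \<in> {1..n} \<times> {1..n} \<rightarrow>\<^sub>E {1..n} \<and>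
     (\<forall>i\<in>{1..n}. \<forall>k\<in>{1..n}. \<exists>!j. j \<in> {1..n} \<and> L (i, j) = k) \<and>
     (\<forall>j\<in>{1..n}. \<forall>k\<in>{1..n}. \<exists>!i. i \<in> {1..n} \<and> L (i, j) = k)"

definition consecutive_mod :: "nat \<Rightarrow> nat \<Rightarrow> nat \<Rightarrow> bool" where
  "consecutive_mod n x y \<longleftrightarrow>
     y = x + 1 \<or> x = y + 1 \<or> (x = 1 \<and> y = n) \<or> (x = n \<and> y = 1)"

definition modular_consecutive_latin_square :: "nat \<Rightarrow> (nat \<times> nat \<Rightarrow> nat) \<Rightarrow> bool" where
  "modular_consecutive_latin_square n L \<longleftrightarrow>
     n > 2 \<and> latin_square n L \<and>
     (\<forall>i\<in>{1..n}. \<forall>j\<in>{1..<n}. consecutive_mod n (L (i, j)) (L (i, j + 1))) \<and>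
     (\<forall>i\<in>{1..<n}. \<forall>j\<in>{1..n}. consecutive_mod n (L (i, j)) (L (i + 1, j)))"

end

theory Submission
  imports Defs "HOL-Number_Theory.Cong"
begin

text \<open>
  Read the entries modulo n. Along a row or a column consecutive entries differ by 1 or -1, and
  since no entry repeats two steps later, the step never changes sign: every row and every column
  is an arithmetic progression with difference 1 or -1. Passing from one row to the next changes
  the entries by the column steps, so if two adjacent rows had different differences, then the
  steps of the columns 1, 2, 3 would form an arithmetic progression with difference 2 or -2
  modulo n; for n > 4 this is impossible for three numbers from 1 and -1. Hence the entry in row i
  and column j is a + c i + r j for fixed signs c, r, and conversely these 4n tables are
  modular consecutive Latin squares.
\<close>

section \<open>Small integers and consecutive entries modulo n\<close>

lemma cong_int_small_imp_eq:
  fixes x y m :: int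
  assumes "[x = y] (mod m)" and "\<bar>x - y\<bar> < m"
  shows "x = y"
proof -
  have "m dvd x - y"
    using assms(1) by (simp add: cong_iff_dvd_diff)
  with assms(2) show ?thesis
    using dvd_imp_le_int[of "x - y" m] by force
qed

lemma cong_table_entry_eq:
  assumes "[int x = int y] (mod int n)" and "x \<in> {1..n}" and "y \<in> {1..n}"
  shows "x = y"
  using cong_int_small_imp_eq[OF assms(1)] assms(2,3) by auto

lemma cong_sign_eq:
  fixes s t m :: int
  assumes "[s = t] (mod m)" and "s \<in> {1, -1}" and "t \<in> {1, -1}" and "m > 2"
  shows "s = t"
  using cong_int_small_imp_eq[OF assms(1)] assms(2-) by auto

text \<open>All differences compared are at most 4 in absolute value, so modulo \<open>m > 4\<close>
  both congruences are equalities, and a progression with difference 2 or -2 cannot have three terms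
  in {1, -1}. The bound is sharp: modulo 4 the signs 1, -1, 1 form a progression with difference
  2.\<close>

lemma sign_progression_const:
  fixes x y z d m :: int
  assumes "[y = x + d] (mod m)" and "[z = y + d] (mod m)"
    and "x \<in> {1, -1}" and "y \<in> {1, -1}" and "z \<in> {1, -1}" and "d \<in> {-2, 0, 2}"
    and "m > 4"
  shows "d = 0"
proof (rule ccontr)
  assume "d \<noteq> 0"
  have "\<bar>y - (x + d)\<bar> \<in> {0, 2, 4}" "\<bar>z - (y + d)\<bar> \<in> {0, 2, 4}"
    using assms(3-6) by auto
  then have "y = x + d" "z = y + d"
    using cong_int_small_imp_eq[OF assms(1)] cong_int_small_imp_eq[OF assms(2)] assms(7) by auto
  with \<open>d \<noteq> 0\<close> show False
    using assms(3-6) by auto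
qed

lemma consecutive_mod_iff_cong:
  assumes "x \<in> {1..n}" and "y \<in> {1..n}"
  shows "consecutive_mod n x y \<longleftrightarrow> (\<exists>d\<in>{1, -1}. [int y = int x + d] (mod int n))"
proof
  assume "consecutive_mod n x y"
  then consider "y = x + 1" | "x = y + 1" | "x = 1" "y = n" | "x = n" "y = 1"
    by (auto simp: consecutive_mod_def)
  then show "\<exists>d\<in>{1, -1}. [int y = int x + d] (mod int n)"
    by cases (auto simp: cong_iff_dvd_diff)
next
  have "int n > 0" using assms by auto
  assume "\<exists>d\<in>{1, -1}. [int y = int x + d] (mod int n)"
  then consider "int n dvd int y - int x - 1" | "int n dvd int y - int x + 1"
    by (auto simp: cong_iff_dvd_diff algebra_simps)
  then show "consecutive_mod n x y"
  proof cases
    case 1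
    then obtain k where k: "int y - int x - 1 = int n * k" by (auto elim: dvdE)
    \<comment> \<open>Since \<open>y - x - 1\<close> lies between \<open>-n\<close> and
      \<open>n - 2\<close>, only two quotients are possible: \<open>k = 0\<close> is the ordinary
      successor, \<open>k = -1\<close> the wrap from \<open>n\<close> to 1. The second case is its
      mirror image.\<close>
    have "int n * k < int n * 1" "int n * (-2) < int n * k"
      unfolding k[symmetric] using assms by auto
    then have "k < 1" "-2 < k"
      using \<open>int n > 0\<close> by (simp_all only: mult_less_cancel_left_pos)
    then have "k = 0 \<or> k = -1" by auto
    with k assms show ?thesis by (auto simp: consecutive_mod_def)
  next
    case 2
    then obtain k where k: "int y - int x + 1 = int n * k" by (auto elim: dvdE)
    have "int n * k < int n * 2" "int n * (-1) < int n * k"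
      unfolding k[symmetric] using assms by auto
    then have "k < 2" "-1 < k"
      using \<open>int n > 0\<close> by (simp_all only: mult_less_cancel_left_pos)
    then have "k = 0 \<or> k = 1" by auto
    with k assms show ?thesis by (auto simp: consecutive_mod_def)
  qed
qed

section \<open>Constant steps along a row or column\<close>

text \<open>Two neighbouring steps of opposite sign would cancel and give
  \<open>f (j + 2) = f j\<close>, against injectivity. An arbitrary sequence \<open>f\<close> lets
  the same argument serve rows and columns.\<close>

lemma unit_steps_const:
  fixes f :: "nat \<Rightarrow> nat"
  assumes "\<And>j. j \<in> {1..n} \<Longrightarrow> f j \<in> {1..n}" and inj: "inj_on f {1..n}"
    and steps: "\<And>j. j \<in> {1..<n} \<Longrightarrow> consecutive_mod n (f j) (f (j + 1))"
  shows "\<exists>d\<in>{1, -1}. \<forall>j\<in>{1..<n}. [int (f (j + 1)) = int (f j) + d] (mod int n)"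
proof -
  have "\<forall>j\<in>{1..<n}. \<exists>d. d \<in> {1, -1} \<and> [int (f (j + 1)) = int (f j) + d] (mod int n)"
  proof
    fix j assume "j \<in> {1..<n}"
    then show "\<exists>d. d \<in> {1, -1} \<and> [int (f (j + 1)) = int (f j) + d] (mod int n)"
      using steps[of j] consecutive_mod_iff_cong[of "f j" n "f (j + 1)"] assms(1)[of j] assms(1)[of "j + 1"]
      by auto
  qed
  then obtain s where s: "\<And>j. j \<in> {1..<n} \<Longrightarrow> s j \<in> {1, -1::int}"
    "\<And>j. j \<in> {1..<n} \<Longrightarrow> [int (f (j + 1)) = int (f j) + s j] (mod int n)"
    by metis
  have const: "s (Suc j) = s j" if "j \<ge> 1" "Suc j < n" for j
  proof (rule ccontr)
    assume "s (Suc j) \<noteq> s j"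
    then have "s j + s (Suc j) = 0"
      using s(1)[of j] s(1)[of "Suc j"] that by auto
    moreover have "[int (f (Suc j)) + s (Suc j) = int (f j) + s j + s (Suc j)] (mod int n)"
      using s(2)[of j] that by (intro cong_add) auto
    moreover have "[int (f (j + 2)) = int (f (Suc j)) + s (Suc j)] (mod int n)"
      using s(2)[of "Suc j"] that by simp
    ultimately have "[int (f (j + 2)) = int (f j)] (mod int n)"
      by (metis add.assoc add.right_neutral cong_trans)
    then have "f (j + 2) = f j"
      using cong_table_entry_eq assms(1)[of j] assms(1)[of "j + 2"] that by auto
    with inj that show False
      by (auto dest: inj_onD[of f _ "j + 2" j])
  qed
  have "s j = s 1" if "j \<ge> 1" "j < n" for j
    using that
  proof (induction j rule: dec_induct)
    case (step j)
    then show ?case using const[of j] by auto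
  qed simp
  \<comment> \<open>For n \<le> 1 there are no steps at all, and either sign is a witness.\<close>
  moreover have "s 1 \<in> {1, -1}" if "n > 1"
    using s(1)[of 1] that by auto
  ultimately show ?thesis
  proof (cases "n > 1")
    case True
    have "\<forall>j\<in>{1..<n}. [int (f (j + 1)) = int (f j) + s 1] (mod int n)"
      using s(2) \<open>\<And>j. j \<ge> 1 \<Longrightarrow> j < n \<Longrightarrow> s j = s 1\<close> by (metis atLeastLessThan_iff)
    with \<open>n > 1 \<Longrightarrow> s 1 \<in> {1, -1}\<close>[OF True] show ?thesis by blast
  qed auto
qed

lemma cong_progression:
  fixes f :: "nat \<Rightarrow> int"
  assumes "\<And>j. j \<in> {1..<n} \<Longrightarrow> [f (j + 1) = f j + d] (mod m)" and "j \<in> {1..n}"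
  shows "[f j = f 1 + d * (int j - 1)] (mod m)"
proof -
  have "1 \<le> j" "j \<le> n" using assms(2) by auto
  then show ?thesis
  proof (induction j rule: dec_induct)
    case (step j)
    then have "[f (j + 1) = f j + d] (mod m)" using assms(1)[of j] by auto
    also have "[f j + d = f 1 + d * (int j - 1) + d] (mod m)"
      using step by (intro cong_add) auto
    finally show ?case by (simp add: algebra_simps)
  qed simp
qed

section \<open>Affine tables\<close>

text \<open>For \<open>n > 0\<close> this is the representative of the residue class of
  \<open>z\<close> in {1..n}; the shift by one before and after \<open>mod\<close> sends multiples
  of \<open>n\<close> to \<open>n\<close> rather than to 0.\<close>

definition table_entry :: "nat \<Rightarrow> int \<Rightarrow> nat" where
  "table_entry n z = nat ((z - 1) mod int n) + 1"

lemma table_entry_range: "n > 0 \<Longrightarrow> table_entry n z \<in> {1..n}"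
  by (auto simp: table_entry_def nat_less_iff Suc_le_eq)

lemma table_entry_cong: "n > 0 \<Longrightarrow> [int (table_entry n z) = z] (mod int n)"
  by (simp add: table_entry_def cong_def mod_add_right_eq)

lemma table_entry_unique:
  assumes "[int x = z] (mod int n)" and "x \<in> {1..n}"
  shows "x = table_entry n z"
  by (rule cong_table_entry_eq[OF _ assms(2) table_entry_range])
    (use assms table_entry_cong[of n z] in \<open>auto intro: cong_trans cong_sym\<close>)

text \<open>The step down a column is \<open>c\<close>, the step along a row is \<open>r\<close>.
  Restricting to the square puts the table into the extensional function space that
  \<open>latin_square\<close> demands.\<close>

definition affine_table :: "nat \<Rightarrow> int \<times> int \<times> int \<Rightarrow> nat \<times> nat \<Rightarrow> nat" where
  "affine_table n = (\<lambda>(a, c, r). restrict (\<lambda>(i, j). table_entry n (a + c * int i + r * int j))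
     ({1..n} \<times> {1..n}))"

lemma affine_table_cong:
  assumes "i \<in> {1..n}" and "j \<in> {1..n}"
  shows "[int (affine_table n (a, c, r) (i, j)) = a + c * int i + r * int j] (mod int n)"
  using assms table_entry_cong[of n] by (simp add: affine_table_def)

lemma affine_table_range:
  assumes "i \<in> {1..n}" and "j \<in> {1..n}"
  shows "affine_table n (a, c, r) (i, j) \<in> {1..n}"
  using assms table_entry_range[of n] by (simp add: affine_table_def)

text \<open>A sign is its own inverse, so modulo \<open>n\<close> the equation
  \<open>b + s * j = k\<close> has the single solution \<open>j = s * (k - b)\<close>, which has one
  representative in {1..n}.\<close>

lemma ex1_table_entry_eq:
  assumes "s \<in> {1, -1}" and "k \<in> {1..n}"
  shows "\<exists>!j. j \<in> {1..n} \<and> table_entry n (b + s * int j) = k"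
proof
  have "n > 0" using assms(2) by auto
  let ?j = "table_entry n (s * (int k - b))"
  have ss: "s * s = 1" using assms(1) by auto
  have "[b + s * int ?j = b + s * (s * (int k - b))] (mod int n)"
    using table_entry_cong[OF \<open>n > 0\<close>] by (intro cong_add cong_mult) auto
  also have "b + s * (s * (int k - b)) = int k"
    using ss by (simp flip: mult.assoc)
  finally have "[int k = b + s * int ?j] (mod int n)" by (rule cong_sym)
  then show "?j \<in> {1..n} \<and> table_entry n (b + s * int ?j) = k"
    using table_entry_unique assms(2) table_entry_range[OF \<open>n > 0\<close>] by metis
  fix j assume j: "j \<in> {1..n} \<and> table_entry n (b + s * int j) = k"
  have "[b + s * int j = int k] (mod int n)"
    using table_entry_cong[OF \<open>n > 0\<close>, of "b + s * int j"] j by (auto intro: cong_sym)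
  then have "[s * (b + s * int j - b) = s * (int k - b)] (mod int n)"
    by (intro cong_mult cong_diff) auto
  then have "[int j = s * (int k - b)] (mod int n)"
    using ss by (simp flip: mult.assoc)
  then show "j = ?j" using table_entry_unique j by blast
qed

text \<open>With one index fixed, the entry is affine in the other with slope 1 or -1, hence takes
  each value once; neighbours differ by \<open>c\<close> or \<open>r\<close> modulo
  \<open>n\<close>.\<close>

lemma modular_consecutive_affine_table:
  assumes "n > 2" and "c \<in> {1, -1}" and "r \<in> {1, -1}"
  shows "modular_consecutive_latin_square n (affine_table n (a, c, r))"
  unfolding modular_consecutive_latin_square_def latin_square_def
proof (intro conjI ballI)
  let ?L = "affine_table n (a, c, r)"
  show "?L \<in> {1..n} \<times> {1..n} \<rightarrow>\<^sub>E {1..n}"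
    using table_entry_range[of n] assms(1) by (auto simp: affine_table_def)
  show "\<exists>!j. j \<in> {1..n} \<and> ?L (i, j) = k" if "i \<in> {1..n}" "k \<in> {1..n}" for i k
    using ex1_table_entry_eq[OF assms(3) that(2), of "a + c * int i"] that(1)
    by (simp add: affine_table_def cong: conj_cong)
  show "\<exists>!i. i \<in> {1..n} \<and> ?L (i, j) = k" if "j \<in> {1..n}" "k \<in> {1..n}" for j k
    using ex1_table_entry_eq[OF assms(2) that(2), of "a + r * int j"] that(1)
    by (simp add: affine_table_def add.assoc add.commute add.left_commute cong: conj_cong)
  \<comment> \<open>Covers both directions: \<open>d\<close> becomes \<open>r\<close> for horizontal
    and \<open>c\<close> for vertical neighbours.\<close>
  have step: "consecutive_mod n (?L p) (?L q)"
    if "p = (i, j)" "q = (i', j')" "i \<in> {1..n}" "j \<in> {1..n}" "i' \<in> {1..n}" "j' \<in> {1..n}"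
      "a + c * int i' + r * int j' = a + c * int i + r * int j + d" "d \<in> {1, -1}" for p q i j i' j' d
  proof -
    have "[int (?L q) = a + c * int i + r * int j + d] (mod int n)"
      using affine_table_cong[of i' n j' a c r] that by simp
    also have "[a + c * int i + r * int j + d = int (?L p) + d] (mod int n)"
      using affine_table_cong[of i n j a c r] that by (intro cong_add) (auto intro: cong_sym)
    finally show ?thesis
      using that affine_table_range by (subst consecutive_mod_iff_cong) auto
  qed
  show "consecutive_mod n (?L (i, j)) (?L (i, j + 1))" if "i \<in> {1..n}" "j \<in> {1..<n}" for i j
    by (rule step[where d = r, OF refl refl]) (use that assms in \<open>auto simp: algebra_simps\<close>)
  show "consecutive_mod n (?L (i, j)) (?L (i + 1, j))" if "i \<in> {1..<n}" "j \<in> {1..n}" for i j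
    by (rule step[where d = c, OF refl refl]) (use that assms in \<open>auto simp: algebra_simps\<close>)
qed (use assms in auto)

section \<open>Every modular consecutive square is affine\<close>

lemma modular_consecutive_is_affine:
  assumes "n > 4" and L: "modular_consecutive_latin_square n L"
  shows "L \<in> affine_table n ` ({0..<int n} \<times> {1, -1} \<times> {1, -1})"
proof -
  have ext: "L \<in> {1..n} \<times> {1..n} \<rightarrow>\<^sub>E {1..n}"
    and rows: "\<forall>i\<in>{1..n}. \<forall>k\<in>{1..n}. \<exists>!j. j \<in> {1..n} \<and> L (i, j) = k"
    and cols: "\<forall>j\<in>{1..n}. \<forall>k\<in>{1..n}. \<exists>!i. i \<in> {1..n} \<and> L (i, j) = k"
    and hor: "\<forall>i\<in>{1..n}. \<forall>j\<in>{1..<n}. consecutive_mod n (L (i, j)) (L (i, j + 1))"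
    and ver: "\<forall>i\<in>{1..<n}. \<forall>j\<in>{1..n}. consecutive_mod n (L (i, j)) (L (i + 1, j))"
    using L unfolding modular_consecutive_latin_square_def latin_square_def
    by - (elim conjE, assumption)+
  have range: "L (i, j) \<in> {1..n}" if "i \<in> {1..n}" "j \<in> {1..n}" for i j
    using ext that by (meson PiE_mem SigmaI)
  have "\<exists>d\<in>{1, -1}. \<forall>j\<in>{1..<n}. [int (L (i, j + 1)) = int (L (i, j)) + d] (mod int n)"
    if i: "i \<in> {1..n}" for i
  proof (rule unit_steps_const[of n "\<lambda>j. L (i, j)"])
    show "inj_on (\<lambda>j. L (i, j)) {1..n}"
      using bspec[OF rows i] range[OF i] by (metis (no_types, lifting) inj_onI)
  qed (use range hor i in auto)
  then obtain r where r: "\<And>i. i \<in> {1..n} \<Longrightarrow> r i \<in> {1, -1::int}"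
    "\<And>i j. i \<in> {1..n} \<Longrightarrow> j \<in> {1..<n} \<Longrightarrow> [int (L (i, j + 1)) = int (L (i, j)) + r i] (mod int n)"
    by metis
  have "\<exists>d\<in>{1, -1}. \<forall>i\<in>{1..<n}. [int (L (i + 1, j)) = int (L (i, j)) + d] (mod int n)"
    if j: "j \<in> {1..n}" for j
  proof (rule unit_steps_const[of n "\<lambda>i. L (i, j)"])
    show "inj_on (\<lambda>i. L (i, j)) {1..n}"
      using bspec[OF cols j] range[OF _ j] by (metis (no_types, lifting) inj_onI)
  qed (use range ver j in auto)
  then obtain c where c: "\<And>j. j \<in> {1..n} \<Longrightarrow> c j \<in> {1, -1::int}"
    "\<And>i j. i \<in> {1..<n} \<Longrightarrow> j \<in> {1..n} \<Longrightarrow> [int (L (i + 1, j)) = int (L (i, j)) + c j] (mod int n)"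
    by metis
  \<comment> \<open>Compare the two paths from (i, j) to (i + 1, j + 1).\<close>
  have corner: "[c (j + 1) = c j + (r (i + 1) - r i)] (mod int n)"
    if "i \<in> {1..<n}" "j \<in> {1..<n}" for i j
  proof -
    have "int n dvd int (L (i, j + 1)) - (int (L (i, j)) + r i)"
      "int n dvd int (L (i + 1, j + 1)) - (int (L (i, j + 1)) + c (j + 1))"
      "int n dvd int (L (i + 1, j)) - (int (L (i, j)) + c j)"
      "int n dvd int (L (i + 1, j + 1)) - (int (L (i + 1, j)) + r (i + 1))"
      using r(2)[of i j] r(2)[of "i + 1" j] c(2)[of i j] c(2)[of i "j + 1"] that
      by (auto simp: cong_iff_dvd_diff)
    from dvd_diff[OF dvd_add[OF this(3,4)] dvd_add[OF this(1,2)]]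
    have "int n dvd c (j + 1) - (c j + (r (i + 1) - r i))"
      by (simp add: algebra_simps)
    then show ?thesis by (simp add: cong_iff_dvd_diff)
  qed
  \<comment> \<open>For a fixed row \<open>i\<close>, the corner relation at columns 1 and 2 makes
    \<open>c 1\<close>, \<open>c 2\<close>, \<open>c 3\<close> a progression of signs with
    difference \<open>r (Suc i) - r i\<close>.\<close>
  have r_step: "r (Suc i) = r i" if "i \<ge> 1" "i < n" for i
  proof -
    have "r (Suc i) - r i = 0"
    proof (rule sign_progression_const)
      show "[c 2 = c 1 + (r (Suc i) - r i)] (mod int n)" "[c 3 = c 2 + (r (Suc i) - r i)] (mod int n)"
        using corner[of i 1] corner[of i 2] that assms(1) by (auto simp: numeral_2_eq_2 numeral_3_eq_3)
      show "r (Suc i) - r i \<in> {-2, 0, 2}"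
        using r(1)[of i] r(1)[of "Suc i"] that by auto
    qed (use c(1) assms(1) in auto)
    then show ?thesis by simp
  qed
  have r_const: "r i = r 1" if "i \<in> {1..n}" for i
  proof -
    have "1 \<le> i" "i \<le> n" using that by auto
    then show ?thesis
    proof (induction i rule: dec_induct)
      case (step i)
      then show ?case using r_step[of i] by auto
    qed simp
  qed
  \<comment> \<open>The value extrapolated to position (0, 0), because indices start at 1. Its
    residue is the offset in {0..<n}.\<close>
  let ?b = "int (L (1, 1)) - c 1 - r 1"
  have entry: "[int (L (i, j)) = ?b mod int n + c 1 * int i + r 1 * int j] (mod int n)"
    if ij: "i \<in> {1..n}" "j \<in> {1..n}" for i j
  proof -
    \<comment> \<open>The cell is reached by going down column 1 with step \<open>c 1\<close> and
      then along row \<open>i\<close> with the common row step \<open>r 1\<close>.\<close>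
    have "[int (L (i, j)) = int (L (i, 1)) + r 1 * (int j - 1)] (mod int n)"
      by (rule cong_progression[of n]) (use r(2)[OF ij(1)] r_const[OF ij(1)] ij in auto)
    also have "[int (L (i, 1)) + r 1 * (int j - 1)
        = int (L (1, 1)) + c 1 * (int i - 1) + r 1 * (int j - 1)] (mod int n)"
      using assms(1) ij(1) c(2)[of _ 1]
      by (intro cong_add cong_progression[of n "\<lambda>i. int (L (i, 1))"]) auto
    also have "int (L (1, 1)) + c 1 * (int i - 1) + r 1 * (int j - 1)
        = ?b + (c 1 * int i + r 1 * int j)"
      by (simp add: algebra_simps)
    also have "[\<dots> = ?b mod int n + (c 1 * int i + r 1 * int j)] (mod int n)"
      by (intro cong_add) (auto simp: cong_def)
    finally show ?thesis by (simp add: add.assoc)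
  qed
  have "L = affine_table n (?b mod int n, c 1, r 1)"
  proof
    fix p show "L p = affine_table n (?b mod int n, c 1, r 1) p"
    proof (cases "p \<in> {1..n} \<times> {1..n}")
      case True
      then obtain i j where p: "p = (i, j)" "i \<in> {1..n}" "j \<in> {1..n}" by auto
      have "L (i, j) = table_entry n (?b mod int n + c 1 * int i + r 1 * int j)"
        by (rule table_entry_unique[OF entry[OF p(2,3)] range[OF p(2,3)]])
      with p show ?thesis by (simp only: affine_table_def split restrict_apply True[unfolded p(1)] if_True)
    next
      \<comment> \<open>Outside the square both functions are \<open>undefined\<close>.\<close>
      case False
      then show ?thesis
        using PiE_arb[OF ext False] by (simp only: affine_table_def split restrict_apply if_False)
    qed
  qed
  moreover have "(?b mod int n, c 1, r 1) \<in> {0..<int n} \<times> {1, -1} \<times> {1, -1}"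
    using assms(1) r(1)[of 1] c(1)[of 1] by auto
  ultimately show ?thesis by blast
qed

section \<open>Counting the affine tables\<close>

text \<open>The differences from the entry at (1, 1) to its right and lower neighbours recover the
  two signs, since 1 and -1 are incongruent modulo \<open>n > 2\<close>. That entry then determines
  the offset modulo \<open>n\<close>, hence in {0..<n}.\<close>

lemma inj_on_affine_table:
  assumes "n > 2"
  shows "inj_on (affine_table n) ({0..<int n} \<times> {1, -1} \<times> {1, -1})"
proof (rule inj_onI)
  fix p q assume p: "p \<in> {0..<int n} \<times> {1, -1} \<times> {1, -1}"
    and q: "q \<in> {0..<int n} \<times> {1, -1} \<times> {1, -1}" and eq: "affine_table n p = affine_table n q"
  obtain a c r where p': "p = (a, c, r)" by (cases p) auto
  obtain a' c' r' where q': "q = (a', c', r')" by (cases q) auto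
  have cong: "[a + c * int i + r * int j = a' + c' * int i + r' * int j] (mod int n)"
    if "i \<in> {1..n}" "j \<in> {1..n}" for i j
    using affine_table_cong[OF that, of a c r] affine_table_cong[OF that, of a' c' r'] eq p' q'
    by (auto intro: cong_trans cong_sym)
  have "[r = r'] (mod int n)"
    using cong_diff[OF cong[of 1 2] cong[of 1 1]] assms by (simp add: algebra_simps)
  then have r: "r = r'"
    by (rule cong_sign_eq) (use p q p' q' assms in auto)
  have "[c = c'] (mod int n)"
    using cong_diff[OF cong[of 2 1] cong[of 1 1]] assms by (simp add: algebra_simps)
  then have c: "c = c'"
    by (rule cong_sign_eq) (use p q p' q' assms in auto)
  have "[a = a'] (mod int n)"
    using cong[of 1 1] assms r c by (simp add: cong_add_rcancel)
  then have "a = a'"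
    by (rule cong_int_small_imp_eq) (use p q p' q' in auto)
  with r c p' q' show "p = q" by simp
qed

theorem corollary8:
  fixes n :: nat
  assumes "n > 4"
  shows "card {L. modular_consecutive_latin_square n L} = 4 * n"
proof -
  let ?P = "{0..<int n} \<times> {1, -1 :: int} \<times> {1, -1 :: int}"
  have "{L. modular_consecutive_latin_square n L} = affine_table n ` ?P"
    using modular_consecutive_is_affine[OF assms] modular_consecutive_affine_table[of n] assms
    by auto
  moreover have "card (affine_table n ` ?P) = card ?P"
    using inj_on_affine_table[of n] assms by (intro card_image) auto
  \<comment> \<open>There are \<open>n\<close> offsets and two choices for each of the two
    signs.\<close>
  ultimately show ?thesis by (simp add: card_cartesian_product)
qed

end
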